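(* For all integers $n\ge 3$, $$\mathrm{ex}(n,\overrightarrow{P_3})=a(\overrightarrow{T_{n,2}})=\left\lfloor \frac{n^2}{4}\right\rfloor .$$ Moreover, $\mathrm{EX}(n,\overrightarrow{P_3})=\overrightarrow{\mathcal{T}_{n,2}}$ for $n\ge 5$, and $\mathrm{EX}(n,\overrightarrow{P_3})=\overrightarrow{\mathcal{T}_{n,2}}\cup\{\overleftrightarrow{\varGamma_{n,2}}\}$ for $n=3,4$.
   Context: Digraphs are finite and strict: no loops and no parallel arcs in the same direction, but both arcs $uv$ and $vu$ may be present. $a(D)$ denotes the number of arcs of a digraph $D$. $\overrightarrow{P_k}$ is the directed path with $k$ vertices (all arcs oriented consistently along the path). A digraph is $H$-free if it contains no (not necessarily induced) subdigraph isomorphic to the digraph $H$. $\mathrm{ex}(n,H)$ is the maximum number of arcs of an $H$-free digraph on $n$ vertices, and $\mathrm{EX}(n,H)$ is the family of all $H$-free digraphs on $n$ vertices with exactly $\mathrm{ex}(n,H)$ arcs. Families of digraphs are considered up to isomorphism. For disjoint vertex sets $U,W$ of a digraph, $U\mapsto W$ means that $uw$ is an arc and $wu$ is not an arc for all $u\in U$, $w\in W$. For $n\ge k\ge 1$, $\overrightarrow{\mathcal{T}_{n,k}}$ is the set of all digraphs $\overrightarrow{T_{n,k}}$ on $n$ vertices whose vertex set has a partition $\{V_1,\dots,V_k\}$ such that: (i) the sizes of the parts differ pairwise by at most $1$; (ii) each $V_i$ is independent (no arcs inside $V_i$); (iii) $V_i\mapsto V_j$ for all $1\le i<j\le k$.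 All members of $\overrightarrow{\mathcal{T}_{n,k}}$ have the same number of arcs, denoted $a(\overrightarrow{T_{n,k}})$. For $n=qk+r$ with $0\le r<k$, $\varGamma_{n,k}$ is the graph that is the disjoint union of $q$ copies of the complete graph $K_k$ and one copy of $K_r$. For a graph $G$, $\overleftrightarrow{G}$ is the digraph obtained from $G$ by replacing every edge $\{u,v\}$ with the two arcs $uv$ and $vu$. *)

theory Defs
  imports
    Complex_Main
    "HOL-Library.Disjoint_Sets"
    "Graph_Theory.Pair_Digraph"
    "Graph_Theory.Digraph_Component"
    "Graph_Theory.Digraph_Isomorphism"
begin

text \<open>
  Finite strict digraphs are the library's \<open>pair_digraph\<close>s: arcs are ordered pairs of vertices, so
  parallel arcs are impossible, while both (u,v) and (v,u) may be arcs. Families of digraphs are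
  sets of digraphs whose vertices are natural numbers; every finite digraph is isomorphic to one
  of these.
\<close>

definition num_arcs :: "'a pair_pre_digraph \<Rightarrow> nat" where
  "num_arcs D = card (parcs D)"

definition directed_path :: "nat \<Rightarrow> nat pair_pre_digraph" where
  "directed_path k = \<lparr> pverts = {1..k}, parcs = {(i, i + 1) | i. 1 \<le> i \<and> i + 1 \<le> k} \<rparr>"

definition H_free :: "'b pair_pre_digraph \<Rightarrow> 'a pair_pre_digraph \<Rightarrow> bool" where
  "H_free H D \<longleftrightarrow>
    \<not> (\<exists>S :: 'a pair_pre_digraph.
          subgraph (with_proj S) (with_proj D) \<and> digraph_iso (with_proj H) (with_proj S))"

definition free_digraphs :: "nat \<Rightarrow> 'b pair_pre_digraph \<Rightarrow> nat pair_pre_digraph set" where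
  "free_digraphs n H = {D. pair_digraph D \<and> card (pverts D) = n \<and> H_free H D}"

definition ex_num :: "nat \<Rightarrow> 'b pair_pre_digraph \<Rightarrow> nat" where
  "ex_num n H = Max (num_arcs ` free_digraphs n H)"

definition EX_fam :: "nat \<Rightarrow> 'b pair_pre_digraph \<Rightarrow> nat pair_pre_digraph set" where
  "EX_fam n H = {D \<in> free_digraphs n H. num_arcs D = ex_num n H}"

text \<open>Equality of families of digraphs considered up to isomorphism.\<close>

definition same_up_to_iso ::
    "'a pair_pre_digraph set \<Rightarrow> 'a pair_pre_digraph set \<Rightarrow> bool" (infix \<open>\<doteq>\<close> 50) where
  "\<F> \<doteq> \<G> \<longleftrightarrow>
     (\<forall>D\<in>\<F>. \<exists>D'\<in>\<G>. digraph_iso (with_proj D) (with_proj D')) \<and>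
     (\<forall>D'\<in>\<G>. \<exists>D\<in>\<F>. digraph_iso (with_proj D) (with_proj D'))"

definition arcs_only_from_to :: "'a pair_pre_digraph \<Rightarrow> 'a set \<Rightarrow> 'a set \<Rightarrow> bool" where
  "arcs_only_from_to D U W \<longleftrightarrow> (\<forall>u\<in>U. \<forall>w\<in>W. (u, w) \<in> parcs D \<and> (w, u) \<notin> parcs D)"

definition turan_partition :: "'a pair_pre_digraph \<Rightarrow> nat \<Rightarrow> (nat \<Rightarrow> 'a set) \<Rightarrow> bool" where
  "turan_partition D k V \<longleftrightarrow>
     inj_on V {1..k} \<and> partition_on (pverts D) (V ` {1..k}) \<and>
     (\<forall>i\<in>{1..k}. \<forall>j\<in>{1..k}. card (V i) \<le> card (V j) + 1) \<and>
     (\<forall>i\<in>{1..k}. \<forall>u\<in>V i. \<forall>v\<in>V i. (u, v) \<notin> parcs D) \<and>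
     (\<forall>i\<in>{1..k}. \<forall>j\<in>{1..k}. i < j \<longrightarrow> arcs_only_from_to D (V i) (V j))"

definition turan_digraphs :: "nat \<Rightarrow> nat \<Rightarrow> nat pair_pre_digraph set" where
  "turan_digraphs n k =
     {D. pair_digraph D \<and> card (pverts D) = n \<and> (\<exists>V. turan_partition D k V)}"

text \<open>
  The common number of arcs of the members of \<^term>\<open>turan_digraphs n k\<close>; it is well defined for
  \<open>1 \<le> k \<le> n\<close>, see \<open>turan_arcs_well_defined\<close> below.
\<close>

definition turan_arcs :: "nat \<Rightarrow> nat \<Rightarrow> nat" where
  "turan_arcs n k = (THE m. num_arcs ` turan_digraphs n k = {m})"

text \<open>Simple graphs are pairs of a vertex set and a set of two-element edges.\<close>

type_synonym 'a sgraph = "'a set \<times> 'a set set"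

definition complete_graph :: "'a set \<Rightarrow> 'a sgraph" where
  "complete_graph S = (S, {{u, v} | u v. u \<in> S \<and> v \<in> S \<and> u \<noteq> v})"

definition graph_Union :: "'a sgraph set \<Rightarrow> 'a sgraph" where
  "graph_Union \<G> = (\<Union> (fst ` \<G>), \<Union> (snd ` \<G>))"

text \<open>
  With \<open>q = n div k\<close>, the vertex set is \<open>{0..<n}\<close>, split into the \<open>q\<close> consecutive blocks
  \<open>{c * k..<c * k + k}\<close> and the remaining \<open>n mod k\<close> vertices \<open>{q * k..<n}\<close>.
\<close>

definition Gamma_graph :: "nat \<Rightarrow> nat \<Rightarrow> nat sgraph" where
  "Gamma_graph n k =
     graph_Union ({complete_graph {c * k..<c * k + k} | c. c < n div k} \<union>
                  {complete_graph {(n div k) * k..<n}})"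

definition bidirect :: "'a sgraph \<Rightarrow> 'a pair_pre_digraph" where
  "bidirect G = \<lparr> pverts = fst G, parcs = {(u, v). {u, v} \<in> snd G} \<rparr>"

lemma turan_partition_arcs:
  assumes D: "pair_digraph D" and V: "turan_partition D k V" and k: "1 \<le> k"
  defines "n \<equiv> card (pverts D)"
  shows "2 * num_arcs D + (k * (n div k)\<^sup>2 + (2 * (n div k) + 1) * (n mod k)) = n\<^sup>2"
proof -
  interpret pair_digraph D by fact
  let ?I = "{1..k}"
  define c where "c = (\<lambda>i. card (V i))"
  have inj: "inj_on V ?I" and part: "partition_on (pverts D) (V ` ?I)"
    and bal: "\<And>i j. i \<in> ?I \<Longrightarrow> j \<in> ?I \<Longrightarrow> c i \<le> c j + 1"
    and indep: "\<And>i u v. i \<in> ?I \<Longrightarrow> u \<in> V i \<Longrightarrow> v \<in> V i \<Longrightarrow> (u, v) \<notin> parcs D"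
    and ord: "\<And>i j. i \<in> ?I \<Longrightarrow> j \<in> ?I \<Longrightarrow> i < j \<Longrightarrow> arcs_only_from_to D (V i) (V j)"
    using V unfolding turan_partition_def c_def by blast+
  have cov: "(\<Union>i\<in>?I. V i) = pverts D"
    using part by (simp add: partition_on_def)
  have dis: "V i \<inter> V j = {}" if "i \<in> ?I" "j \<in> ?I" "i \<noteq> j" for i j
  proof -
    have "V i \<noteq> V j" using inj_onD[OF inj] that by blast
    moreover have "V i \<in> V ` ?I" "V j \<in> V ` ?I" using that(1,2) by blast+
    ultimately show ?thesis using disjointD[OF partition_onD2[OF part]] by simp
  qed
  have finV: "finite (V i)" if "i \<in> ?I" for i
    by (rule finite_subset[OF _ pair_finite_verts]) (use cov that in blast)
  have n: "n = (\<Sum>i\<in>?I. c i)"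
    unfolding n_def c_def cov[symmetric]
  proof (rule card_UN_disjoint)
    show "\<forall>i\<in>?I. finite (V i)" using finV by blast
    show "\<forall>i\<in>?I. \<forall>j\<in>?I. i \<noteq> j \<longrightarrow> V i \<inter> V j = {}"
      using dis by blast
  qed simp
  define P where "P = Sigma ?I (\<lambda>i. {j\<in>?I. i < j})"
  have parcs_eq: "parcs D = (\<Union>(i,j)\<in>P. V i \<times> V j)"
  proof (intro set_eqI iffI)
    fix e assume e: "e \<in> parcs D"
    obtain u v where uv: "e = (u, v)" by (cases e)
    have "u \<in> pverts D" "v \<in> pverts D" using e uv in_arcsD1 in_arcsD2 by auto
    then obtain i j where ij: "i \<in> ?I" "j \<in> ?I" "u \<in> V i" "v \<in> V j" using cov by blast
    have "i < j"
    proof (rule ccontr)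
      assume "\<not> i < j"
      then consider "i = j" | "j < i" by linarith
      then show False
      proof cases
        case 1
        then show False using indep[OF ij(2), of u v] ij(3,4) e uv by simp
      next
        case 2
        then show False
          using ord[OF ij(2,1)] ij(3,4) e uv unfolding arcs_only_from_to_def by blast
      qed
    qed
    then have "(i, j) \<in> P" using ij unfolding P_def by simp
    then show "e \<in> (\<Union>(i,j)\<in>P. V i \<times> V j)" using ij uv by blast
  next
    fix e assume "e \<in> (\<Union>(i,j)\<in>P. V i \<times> V j)"
    then obtain i j u v where "(i, j) \<in> P" "u \<in> V i" "v \<in> V j" "e = (u, v)" by blast
    then show "e \<in> parcs D" using ord[of i j] unfolding P_def arcs_only_from_to_def by simp
  qed
  have finP: "finite P" unfolding P_def by (intro finite_SigmaI) auto
  have "num_arcs D = (\<Sum>p\<in>P. card (V (fst p) \<times> V (snd p)))"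
    unfolding num_arcs_def parcs_eq case_prod_beta
  proof (rule card_UN_disjoint[OF finP])
    show "\<forall>p\<in>P. finite (V (fst p) \<times> V (snd p))"
      using finV unfolding P_def by (auto intro!: finite_cartesian_product simp del: atLeastAtMost_iff)
    show "\<forall>p\<in>P. \<forall>p'\<in>P. p \<noteq> p' \<longrightarrow>
        (V (fst p) \<times> V (snd p)) \<inter> (V (fst p') \<times> V (snd p')) = {}"
    proof (intro ballI impI)
      fix p p' assume p: "p \<in> P" "p' \<in> P" "p \<noteq> p'"
      then have "fst p \<in> ?I" "snd p \<in> ?I" "fst p' \<in> ?I" "snd p' \<in> ?I" unfolding P_def by auto
      moreover have "fst p \<noteq> fst p' \<or> snd p \<noteq> snd p'" using p(3) by (simp add: prod_eq_iff)
      ultimately have "V (fst p) \<inter> V (fst p') = {} \<or> V (snd p) \<inter> V (snd p') = {}"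
        using dis[of "fst p" "fst p'"] dis[of "snd p" "snd p'"] by argo
      then show "(V (fst p) \<times> V (snd p)) \<inter> (V (fst p') \<times> V (snd p')) = {}" by blast
    qed
  qed
  then have a: "num_arcs D = (\<Sum>(i,j)\<in>P. c i * c j)"
    by (simp add: card_cartesian_product c_def case_prod_beta)
  define Q where "Q = prod.swap ` P"
  define R where "R = (\<lambda>i. (i, i)) ` ?I"
  have IPQR: "?I \<times> ?I = (P \<union> Q) \<union> R"
  proof (intro set_eqI iffI)
    fix p assume p: "p \<in> ?I \<times> ?I"
    consider "p \<in> P" | "prod.swap p \<in> P" | "p \<in> R"
      using p unfolding P_def R_def by (cases "fst p" "snd p" rule: linorder_cases) auto
    then show "p \<in> (P \<union> Q) \<union> R"
    proof cases
      case 2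
      then have "prod.swap (prod.swap p) \<in> Q" unfolding Q_def by (rule imageI)
      then show ?thesis by simp
    qed simp_all
  qed (auto simp: P_def Q_def R_def)
  have PQ: "P \<inter> Q = {}" "(P \<union> Q) \<inter> R = {}" unfolding P_def Q_def R_def by auto
  have fin: "finite Q" "finite R" using finP unfolding Q_def R_def by auto
  have sq: "n\<^sup>2 = (\<Sum>(i,j)\<in>?I \<times> ?I. c i * c j)"
    unfolding n power2_eq_square by (simp add: sum_product sum.cartesian_product)
  have sQ: "(\<Sum>(i,j)\<in>Q. c i * c j) = (\<Sum>(i,j)\<in>P. c i * c j)"
    unfolding Q_def by (subst sum.reindex) (auto simp: case_prod_beta mult.commute)
  have sR: "(\<Sum>(i,j)\<in>R. c i * c j) = (\<Sum>i\<in>?I. (c i)\<^sup>2)"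
    unfolding R_def by (subst sum.reindex) (auto simp: inj_on_def power2_eq_square)
  have main: "n\<^sup>2 = 2 * num_arcs D + (\<Sum>i\<in>?I. (c i)\<^sup>2)"
    unfolding sq IPQR using PQ fin finP sQ sR a by (simp add: sum.union_disjoint)
  define m where "m = Min (c ` ?I)"
  have "m \<in> c ` ?I" unfolding m_def using k by (intro Min_in) auto
  then obtain i0 where i0: "i0 \<in> ?I" "c i0 = m" by auto
  have ge: "m \<le> c i" if "i \<in> ?I" for i unfolding m_def using that by auto
  define B where "B = {i\<in>?I. c i = m + 1}"
  have c_eq: "c i = m + (if i \<in> B then 1 else 0)" if "i \<in> ?I" for i
    using ge[OF that] bal[OF that i0(1)] i0(2) that unfolding B_def by auto
  have sub: "B \<subseteq> ?I" and ni: "i0 \<notin> B" using i0(2) unfolding B_def by auto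
  then have "B \<subset> ?I" using i0(1) by blast
  then have Bk: "card B < k" using psubset_card_mono[of ?I B] by simp
  have sB: "(\<Sum>i\<in>?I. if i \<in> B then (1::nat) else 0) = card B"
    using sum.inter_restrict[of ?I "\<lambda>_. 1::nat" B] Int_absorb1[OF sub] by simp
  have "n = (\<Sum>i\<in>?I. m + (if i \<in> B then 1 else 0))"
    unfolding n by (rule sum.cong[OF refl c_eq])
  also have "\<dots> = k * m + card B"
    unfolding sum.distrib sB by simp
  finally have nk: "n = k * m + card B" .
  have nd: "n div k = m" "n mod k = card B" using nk Bk by auto
  have "(\<Sum>i\<in>?I. (c i)\<^sup>2) = (\<Sum>i\<in>?I. m\<^sup>2 + (2 * m + 1) * (if i \<in> B then 1 else 0))"
  proof (rule sum.cong[OF refl])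
    fix i assume "i \<in> ?I"
    show "(c i)\<^sup>2 = m\<^sup>2 + (2 * m + 1) * (if i \<in> B then 1 else 0)"
      unfolding c_eq[OF \<open>i \<in> ?I\<close>] by (simp add: power2_eq_square)
  qed
  also have "\<dots> = k * m\<^sup>2 + (2 * m + 1) * card B"
    unfolding sum.distrib sum_distrib_left[symmetric] sB by simp
  finally show ?thesis using main nd by simp
qed

lemma turan_digraphs_nonempty:
  assumes "1 \<le> k" "k \<le> n"
  shows "turan_digraphs n k \<noteq> {}"
proof -
  define V where "V = (\<lambda>i. {v. v < n \<and> v mod k + 1 = i})"
  define D where "D = \<lparr> pverts = {..<n}, parcs = {(u, v). u < n \<and> v < n \<and> u mod k < v mod k} \<rparr>"
  have fin: "finite (parcs D)"
    by (rule finite_subset[of _ "{..<n} \<times> {..<n}"]) (auto simp: D_def)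
  have D: "pair_digraph D"
    using fin by unfold_locales (auto simp: D_def)
  have ne: "i - 1 \<in> V i" if "i \<in> {1..k}" for i using that assms unfolding V_def by auto
  have inj: "inj_on V {1..k}"
  proof (rule inj_onI)
    fix i j assume "i \<in> {1..k}" "j \<in> {1..k}" "V i = V j"
    then have "i - 1 \<in> V j" using ne by metis
    then show "i = j" using \<open>i \<in> {1..k}\<close> ne[of i] unfolding V_def by auto
  qed
  have part: "partition_on (pverts D) (V ` {1..k})"
    unfolding partition_on_def disjoint_def
  proof (intro conjI)
    show "\<Union> (V ` {1..k}) = pverts D"
      using assms unfolding V_def D_def by (auto simp: Suc_le_eq)
    show "\<forall>a\<in>V ` {1..k}. \<forall>b\<in>V ` {1..k}. a \<noteq> b \<longrightarrow> a \<inter> b = {}"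
      unfolding V_def by auto
    show "{} \<notin> V ` {1..k}" using ne by blast
  qed
  have card: "n div k \<le> card (V i) \<and> card (V i) \<le> n div k + 1" if i: "i \<in> {1..k}" for i
  proof
    have inj': "inj (\<lambda>j. j * k + (i - 1))" using assms by (auto simp: inj_def)
    have sub1: "(\<lambda>j. j * k + (i - 1)) ` {..<n div k} \<subseteq> V i"
    proof
      fix v assume "v \<in> (\<lambda>j. j * k + (i - 1)) ` {..<n div k}"
      then obtain j where j: "j < n div k" "v = j * k + (i - 1)" by auto
      have "(j + 1) * k \<le> (n div k) * k" using j by (intro mult_right_mono) auto
      also have "\<dots> \<le> n" by simp
      finally have "(j + 1) * k \<le> n" .
      moreover have "(i - 1 + j * k) mod k = i - 1" using i by (subst mod_mult_self1) auto
      moreover have "v < (j + 1) * k" "i - 1 + 1 = i" using i j by auto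
      ultimately show "v \<in> V i" unfolding V_def j(2) by (simp add: add.commute)
    qed
    have sub2: "V i \<subseteq> (\<lambda>j. j * k + (i - 1)) ` {..n div k}"
    proof
      fix v assume v: "v \<in> V i"
      then have "v = (v div k) * k + (i - 1)" unfolding V_def by auto
      moreover have "v div k \<le> n div k" using v unfolding V_def by (auto intro: div_le_mono)
      ultimately show "v \<in> (\<lambda>j. j * k + (i - 1)) ` {..n div k}" by blast
    qed
    show "n div k \<le> card (V i)"
      using card_mono[OF _ sub1] card_image[OF inj_on_subset[OF inj' subset_UNIV], of "{..<n div k}"]
      by (simp add: V_def)
    show "card (V i) \<le> n div k + 1"
      using card_mono[OF _ sub2] card_image[OF inj_on_subset[OF inj' subset_UNIV], of "{..n div k}"]
      by simp
  qed
  have "turan_partition D k V"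
    unfolding turan_partition_def
  proof (intro conjI ballI impI)
    fix i j assume "i \<in> {1..k}" "j \<in> {1..k}"
    then show "card (V i) \<le> card (V j) + 1" using card[of i] card[of j] by linarith
  qed (use inj part in \<open>auto simp: V_def D_def arcs_only_from_to_def\<close>)
  moreover have "card (pverts D) = n" by (simp add: D_def)
  ultimately show ?thesis using D unfolding turan_digraphs_def by blast
qed

lemma turan_arcs_well_defined:
  assumes "1 \<le> k" "k \<le> n"
  shows "num_arcs ` turan_digraphs n k = {turan_arcs n k}"
proof -
  obtain D where D: "D \<in> turan_digraphs n k" using turan_digraphs_nonempty[OF assms] by blast
  have "num_arcs D' = num_arcs D" if D': "D' \<in> turan_digraphs n k" for D'
  proof -
    obtain V where "pair_digraph D" "turan_partition D k V" "card (pverts D) = n"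
      using D unfolding turan_digraphs_def by blast
    note 1 = turan_partition_arcs[OF this(1,2) assms(1), unfolded this(3)]
    obtain V' where "pair_digraph D'" "turan_partition D' k V'" "card (pverts D') = n"
      using D' unfolding turan_digraphs_def by blast
    note 2 = turan_partition_arcs[OF this(1,2) assms(1), unfolded this(3)]
    from 1 2 have "2 * num_arcs D' = 2 * num_arcs D" by (metis add_right_cancel)
    then show ?thesis by simp
  qed
  then have eq: "num_arcs ` turan_digraphs n k = {num_arcs D}" using D by blast
  then show ?thesis unfolding turan_arcs_def by simp
qed

end

theory Submission
  imports Defs
begin

text \<open>
  In a digraph without a directed path on three vertices, a pair of opposite arcs touches no
  further arc, and every vertex on no such pair is a pure source or a pure sink. If \<open>a\<close> vertices
  lie on opposite pairs and there are \<open>s\<close> sources and \<open>t\<close> sinks, then there are at most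
  \<open>a + s t\<close> arcs, where \<open>n = a + s + t\<close>. Since
  \<open>n\<^sup>2 - 4 (a + s t) = (s - t)\<^sup>2 + a (2 n - a - 4)\<close>, and \<open>a\<close> is even, \<open>\<lfloor>n\<^sup>2 / 4\<rfloor>\<close> is an upper
  bound, attained with \<open>a > 0\<close> only for \<open>n = 3\<close> and for \<open>n = a = 4\<close>.
\<close>

section \<open>Isomorphisms of pair digraphs and freeness from the three-vertex path\<close>

text \<open>An arc is determined by its endpoints, so a vertex map extends to arcs only as
  \<open>map_prod f f\<close>. Building an isomorphism thus reduces to comparing vertex and arc
  sets.\<close>

lemma digraph_iso_with_projI:
  assumes "pair_wf_digraph D" "inj_on f (pverts D)"
    and "pverts D' = f ` pverts D" "parcs D' = map_prod f f ` parcs D"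
  shows "digraph_iso (with_proj D) (with_proj D')"
proof -
  interpret pair_wf_digraph D by fact
  \<comment> \<open>Keeping \<open>fst\<close> and \<open>snd\<close> as tail and head makes the
    image again of the form \<open>with_proj\<close>.\<close>
  let ?h = "\<lparr>iso_verts = f, iso_arcs = map_prod f f, iso_head = snd, iso_tail = fst\<rparr>"
  have "parcs D \<subseteq> pverts D \<times> pverts D"
    using in_arcsD1 in_arcsD2 by auto
  then have "inj_on (map_prod f f) (parcs D)"
    using map_prod_inj_on[OF assms(2,2)] inj_on_subset by blast
  then have "digraph_isomorphism ?h"
    using assms(2) by (simp add: digraph_isomorphism_def wf_digraph_axioms)
  moreover have "with_proj D' = app_iso ?h (with_proj D)"
    using assms(3,4) by (simp add: app_iso_def with_proj_def)
  ultimately show ?thesis unfolding digraph_iso_def by blast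
qed

lemma digraph_iso_with_projE:
  assumes "digraph_iso (with_proj D) (with_proj D')"
  obtains f where "inj_on f (pverts D)" "\<And>u v. (u, v) \<in> parcs D \<Longrightarrow> (f u, f v) \<in> parcs D'"
proof -
  obtain h where h: "pre_digraph.digraph_isomorphism (with_proj D) h"
    and D': "with_proj D' = app_iso h (with_proj D)"
    using assms unfolding digraph_iso_def by blast
  have th: "iso_tail h = fst" "iso_head h = snd" "parcs D' = iso_arcs h ` parcs D"
    using D' by (simp_all add: app_iso_def with_proj_def)
  show thesis
  proof
    show "inj_on (iso_verts h) (pverts D)"
      using h by (simp add: pre_digraph.digraph_isomorphism_def)
  next
    fix u v assume uv: "(u, v) \<in> parcs D"
    then have "iso_arcs h (u, v) = (iso_verts h u, iso_verts h v)"
      using h th by (fastforce simp: pre_digraph.digraph_isomorphism_def prod_eq_iff)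
    then show "(iso_verts h u, iso_verts h v) \<in> parcs D'"
      using uv th(3) by force
  qed
qed

lemma directed_path_3: "directed_path 3 = \<lparr>pverts = {1, 2, 3}, parcs = {(1, 2), (2, 3)}\<rparr>"
proof -
  have "{(i, i + 1) |i. 1 \<le> i \<and> i + 1 \<le> (3::nat)} = {(1, 2), (2, 3)}"
  proof (intro set_eqI iffI)
    fix e assume "e \<in> {(i, i + 1) |i. 1 \<le> i \<and> i + 1 \<le> (3::nat)}"
    then obtain i where "e = (i, i + 1)" "i = 1 \<or> i = 2" by force
    then show "e \<in> {(1, 2), (2, 3)}" by auto
  qed auto
  moreover have "{1..3::nat} = {1, 2, 3}" by auto
  ultimately show ?thesis by (simp add: directed_path_def)
qed

text \<open>Since there are no loops, two consecutive arcs from \<open>u\<close> through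
  \<open>v\<close> to \<open>w\<close> form a path on three vertices unless \<open>u = w\<close>.
  This replaces copies up to isomorphism by a condition on arcs.\<close>

lemma P3_free_iff:
  assumes "pair_digraph D"
  shows "H_free (directed_path 3) D \<longleftrightarrow>
    (\<forall>u v w. (u, v) \<in> parcs D \<longrightarrow> (v, w) \<in> parcs D \<longrightarrow> u = w)"
    (is "_ \<longleftrightarrow> ?R")
proof -
  interpret pair_digraph D by fact
  show ?thesis
  proof
    assume free: "H_free (directed_path 3) D"
    show ?R
    proof (intro allI impI, rule ccontr)
      fix u v w assume uv: "(u, v) \<in> parcs D" and vw: "(v, w) \<in> parcs D" and "u \<noteq> w"
      have ne: "u \<noteq> v" "v \<noteq> w" using pair_no_loops uv vw by force+
      define S where "S = \<lparr>pverts = {u, v, w}, parcs = {(u, v), (v, w)}\<rparr>"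
      have wf: "pair_wf_digraph S" "pair_wf_digraph (directed_path 3)"
        by unfold_locales (auto simp: S_def directed_path_3)
      have "subgraph (with_proj S) (with_proj D)"
        using wf uv vw in_arcsD1 in_arcsD2 wf_digraph_axioms
        by (intro subgraphI) (auto simp: wf_digraph_wp_iff, auto simp: S_def)
      moreover have "digraph_iso (with_proj (directed_path 3)) (with_proj S)"
        by (rule digraph_iso_with_projI[where f = "\<lambda>i. if i = 1 then u else if i = 2 then v else w"])
          (use wf ne \<open>u \<noteq> w\<close> in \<open>auto simp: directed_path_3 S_def\<close>)
      ultimately show False using free unfolding H_free_def by blast
    qed
  next
    assume R: ?R
    show "H_free (directed_path 3) D"
      unfolding H_free_def
    proof (intro notI, elim exE conjE)
      fix S assume sub: "subgraph (with_proj S) (with_proj D)"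
        and "digraph_iso (with_proj (directed_path 3)) (with_proj S)"
      then obtain f where f: "inj_on f {1, 2, 3::nat}" "(f 1, f 2) \<in> parcs S" "(f 2, f 3) \<in> parcs S"
        by (auto simp: directed_path_3 elim!: digraph_iso_with_projE)
      moreover have "parcs S \<subseteq> parcs D" using sub by (auto simp: subgraph_def)
      ultimately have "(f 1, f 2) \<in> parcs D" "(f 2, f 3) \<in> parcs D" by blast+
      then have "f 1 = f 3" by (rule R[rule_format])
      then show False using inj_onD[OF f(1), of 1 3] by simp
    qed
  qed
qed

section \<open>Structure of digraphs without the three-vertex path\<close>

locale P3_free_digraph = pair_digraph D for D :: "'a pair_pre_digraph" +
  assumes P3_free: "(u, v) \<in> parcs D \<Longrightarrow> (v, w) \<in> parcs D \<Longrightarrow> u = w"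
begin

definition "digon_verts = {u. \<exists>v. (u, v) \<in> parcs D \<and> (v, u) \<in> parcs D}"
definition "sources = {u \<in> pverts D - digon_verts. \<exists>v. (u, v) \<in> parcs D}"
text \<open>Isolated vertices fall among the sinks, so that every vertex off the digons (pairs of
  opposite arcs) is a source or a sink.\<close>

definition "sinks = {u \<in> pverts D - digon_verts. \<nexists>v. (u, v) \<in> parcs D}"

lemma arc_neq: "(u, v) \<in> parcs D \<Longrightarrow> u \<noteq> v"
  using pair_no_loops by force

lemma finite_parts: "finite digon_verts" "finite sources" "finite sinks"
proof -
  have "digon_verts \<subseteq> pverts D" by (auto simp: digon_verts_def in_arcsD1)
  then show "finite digon_verts" "finite sources" "finite sinks"
    using pair_finite_verts by (auto intro: finite_subset simp: sources_def sinks_def)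
qed

lemma card_verts: "card (pverts D) = card digon_verts + card sources + card sinks"
proof -
  have "pverts D = (digon_verts \<union> sources) \<union> sinks"
    by (auto simp: digon_verts_def sources_def sinks_def in_arcsD1)
  moreover have "digon_verts \<inter> sources = {}" "(digon_verts \<union> sources) \<inter> sinks = {}"
    by (auto simp: sources_def sinks_def)
  ultimately show ?thesis using finite_parts by (simp add: card_Un_disjoint)
qed

text \<open>If the tail \<open>u\<close> of an arc lies on no digon, its head has no out-arc: such
  an arc would have to return to \<open>u\<close>. Hence the head is on no digon either.\<close>

lemma arcs_outside_digons: "{e \<in> parcs D. fst e \<notin> digon_verts} \<subseteq> sources \<times> sinks"
proof
  fix e assume "e \<in> {e \<in> parcs D. fst e \<notin> digon_verts}"
  then obtain u v where e: "e = (u, v)" "(u, v) \<in> parcs D" "u \<notin> digon_verts" by (cases e) auto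
  then have "(v, w) \<notin> parcs D" for w
    using P3_free[of u v w] by (auto simp: digon_verts_def)
  then show "e \<in> sources \<times> sinks"
    using e by (auto simp: sources_def sinks_def digon_verts_def in_arcsD1 in_arcsD2)
qed

text \<open>The head of an arc leaving a digon vertex is determined by its tail.\<close>

lemma card_arcs_from_digons: "card {e \<in> parcs D. fst e \<in> digon_verts} \<le> card digon_verts"
proof (rule card_inj_on_le[where f = fst])
  show "inj_on fst {e \<in> parcs D. fst e \<in> digon_verts}"
  proof (rule inj_onI)
    fix e e' assume e: "e \<in> {e \<in> parcs D. fst e \<in> digon_verts}"
      "e' \<in> {e \<in> parcs D. fst e \<in> digon_verts}" "fst e = fst e'"
    then obtain v where "(v, fst e) \<in> parcs D" by (auto simp: digon_verts_def)
    moreover have "(fst e, snd e) \<in> parcs D" using e(1) by simp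
    moreover have "(fst e, snd e') \<in> parcs D" unfolding e(3) using e(2) by simp
    \<comment> \<open>The digon partner \<open>v\<close> sends an arc into the common tail, so every
      out-arc must go back to \<open>v\<close>.\<close>
    ultimately have "v = snd e" "v = snd e'" using P3_free by blast+
    then show "e = e'" using e(3) by (simp add: prod_eq_iff)
  qed
qed (use finite_parts in auto)

lemma num_arcs_le: "num_arcs D \<le> card digon_verts + card sources * card sinks"
proof -
  have "parcs D = {e \<in> parcs D. fst e \<in> digon_verts} \<union> {e \<in> parcs D. fst e \<notin> digon_verts}"
    by blast
  then have "num_arcs D = card ({e \<in> parcs D. fst e \<in> digon_verts} \<union>
      {e \<in> parcs D. fst e \<notin> digon_verts})"
    by (simp add: num_arcs_def)
  also have "\<dots> \<le> card {e \<in> parcs D. fst e \<in> digon_verts} +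
      card {e \<in> parcs D. fst e \<notin> digon_verts}"
    by (rule card_Un_le)
  also have "\<dots> \<le> card digon_verts + card sources * card sinks"
    using card_arcs_from_digons card_mono[OF _ arcs_outside_digons] finite_parts
    by (simp add: add_mono card_cartesian_product)
  finally show ?thesis .
qed

text \<open>Four times \<open>num_arcs_le\<close>, rewritten with n = a + s + t. Integers are used
  because the factor \<open>2 * n - a - 4\<close> can be negative, for instance for a single digon
  with n = a = 2.\<close>

lemma deficit_le:
  fixes n a :: int
  defines "n \<equiv> int (card (pverts D))" and "a \<equiv> int (card digon_verts)"
  shows "(int (card sources) - int (card sinks))\<^sup>2 + a * (2 * n - a - 4) \<le> n\<^sup>2 - 4 * int (num_arcs D)"
proof -
  have "int (num_arcs D) \<le> int (card digon_verts + card sources * card sinks)"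
    using num_arcs_le of_nat_mono by blast
  then show ?thesis
    unfolding n_def a_def card_verts by (simp add: power2_eq_square algebra_simps)
qed

text \<open>A further arc at \<open>u\<close> or \<open>v\<close> would extend one of the two
  opposite arcs to a path on three vertices. Each of the four possible incidences fixes the other
  endpoint.\<close>

lemma digon_nbrs:
  assumes "(u, v) \<in> parcs D" "(v, u) \<in> parcs D" "e \<in> parcs D"
    "fst e \<in> {u, v} \<or> snd e \<in> {u, v}"
  shows "e = (u, v) \<or> e = (v, u)"
proof -
  obtain x y where e: "e = (x, y)" by (cases e)
  have "y = v" if "x = u" using P3_free[OF assms(2), of y] assms(3) that e by simp
  moreover have "y = u" if "x = v" using P3_free[OF assms(1), of y] assms(3) that e by simp
  moreover have "x = v" if "y = u" using P3_free[OF _ assms(1), of x] assms(3) that e by simp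
  moreover have "x = u" if "y = v" using P3_free[OF _ assms(2), of x] assms(3) that e by simp
  moreover have "x = u \<or> x = v \<or> y = u \<or> y = v" using assms(4) e by auto
  ultimately show ?thesis unfolding e by blast
qed

text \<open>Among three vertices every arc meets the digon, as only one vertex lies off it and loops
  are absent; \<open>digon_nbrs\<close> then leaves just the digon.\<close>

lemma digon_order_3:
  assumes "card (pverts D) = 3" "digon_verts \<noteq> {}"
  obtains u v w where "pverts D = {u, v, w}" "distinct [u, v, w]" "parcs D = {(u, v), (v, u)}"
proof -
  obtain u v where uv: "(u, v) \<in> parcs D" "(v, u) \<in> parcs D"
    using assms(2) by (auto simp: digon_verts_def)
  then have "u \<noteq> v" "u \<in> pverts D" "v \<in> pverts D" using arc_neq in_arcsD1 by blast+
  then have "card (pverts D - {u, v}) = 1"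
    using assms(1) by (subst card_Diff_subset) auto
  then obtain w where w: "pverts D - {u, v} = {w}" using card_1_singletonE by blast
  then have V: "pverts D = {u, v, w}" "distinct [u, v, w]"
    using \<open>u \<noteq> v\<close> \<open>u \<in> pverts D\<close> \<open>v \<in> pverts D\<close> by auto
  have "parcs D = {(u, v), (v, u)}"
  proof (intro equalityI subsetI)
    fix e assume e: "e \<in> parcs D"
    then have "fst e \<in> pverts D" "snd e \<in> pverts D" "fst e \<noteq> snd e"
      by (rule arc_fst_in_verts arc_snd_in_verts pair_no_loops)+
    then have "fst e \<in> {u, v} \<or> snd e \<in> {u, v}" unfolding V(1) by auto
    then show "e \<in> {(u, v), (v, u)}" using digon_nbrs[OF uv e] by simp
  qed (use uv in auto)
  then show thesis using V that by blast
qed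

lemma digons_order_4:
  assumes "card (pverts D) = 4" "card digon_verts = 4"
  obtains u v w x where "pverts D = {u, v, w, x}" "distinct [u, v, w, x]"
    "parcs D = {(u, v), (v, u), (w, x), (x, w)}"
proof -
  have "digon_verts \<subseteq> pverts D" by (auto simp: digon_verts_def in_arcsD1)
  then have all: "digon_verts = pverts D"
    using assms pair_finite_verts by (intro card_subset_eq) auto
  then have "digon_verts \<noteq> {}" using assms by auto
  then obtain u v where uv: "(u, v) \<in> parcs D" "(v, u) \<in> parcs D"
    by (auto simp: digon_verts_def)
  then have "u \<noteq> v" "u \<in> pverts D" "v \<in> pverts D" using arc_neq in_arcsD1 by blast+
  then have "card (pverts D - {u, v}) = 2"
    using assms(1) by (subst card_Diff_subset) auto
  then obtain w x where w: "pverts D - {u, v} = {w, x}" "w \<noteq> x" by (auto simp: card_2_iff)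
  then have V: "pverts D = {u, v, w, x}" "distinct [u, v, w, x]"
    using \<open>u \<noteq> v\<close> \<open>u \<in> pverts D\<close> \<open>v \<in> pverts D\<close> by auto
  then have "w \<in> digon_verts" using all by auto
  then obtain y where y: "(w, y) \<in> parcs D" "(y, w) \<in> parcs D" by (auto simp: digon_verts_def)
  then have "y \<in> {u, v, w, x}" "y \<noteq> w" using in_arcsD2 arc_neq V(1) by blast+
  \<comment> \<open>A digon cannot share a vertex with another one, so the partner of
    \<open>w\<close> must be \<open>x\<close>.\<close>
  moreover have "y \<notin> {u, v}"
    using digon_nbrs[OF uv y(1)] V(2) by auto
  ultimately have wx: "(w, x) \<in> parcs D" "(x, w) \<in> parcs D" using y by auto
  have "parcs D = {(u, v), (v, u), (w, x), (x, w)}"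
  proof (intro equalityI subsetI)
    fix e assume e: "e \<in> parcs D"
    then have "fst e \<in> pverts D" by (rule arc_fst_in_verts)
    then have "fst e \<in> {u, v} \<or> fst e \<in> {w, x}" unfolding V(1) by blast
    then show "e \<in> {(u, v), (v, u), (w, x), (x, w)}"
      using digon_nbrs[OF uv e] digon_nbrs[OF wx e] by blast
  qed (use uv wx in auto)
  then show thesis using V that by blast
qed

section \<open>The upper bound and the case of equality\<close>

lemma num_arcs_le_Mantel:
  assumes "card (pverts D) \<ge> 3"
  shows "4 * num_arcs D \<le> (card (pverts D))\<^sup>2"
\<comment> \<open>From a \<le> n alone, the factor \<open>2 * n - a - 4\<close> is nonnegative once
  n \<ge> 4, but could be -1 for n = 3. That order is settled by listing the arcs.\<close>
proof (cases "card (pverts D) = 3 \<and> digon_verts \<noteq> {}")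
  case True
  obtain u v w where "pverts D = {u, v, w}" "distinct [u, v, w]" "parcs D = {(u, v), (v, u)}"
    by (rule digon_order_3) (use True in auto)
  then have "num_arcs D \<le> 2" unfolding num_arcs_def by (simp add: card_insert_if)
  then show ?thesis using True by simp
next
  case outer: False
  have "0 \<le> int (card digon_verts) * (2 * int (card (pverts D)) - int (card digon_verts) - 4)"
  proof (cases "digon_verts = {}")
    case False
    then have "card (pverts D) \<ge> 4" using assms outer by simp
    then show ?thesis using card_verts by (intro mult_nonneg_nonneg) auto
  qed simp
  then have "0 \<le> (int (card (pverts D)))\<^sup>2 - 4 * int (num_arcs D)"
    using deficit_le zero_le_power2[of "int (card sources) - int (card sinks)"] by linarith
  then have "int (4 * num_arcs D) \<le> int ((card (pverts D))\<^sup>2)" by simp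
  then show ?thesis by (simp only: of_nat_le_iff)
qed

text \<open>Without digons all arcs run from sources to sinks. Extremality makes the deficit less
  than 4, which balances the two classes, and then leaves no source-sink pair without an
  arc.\<close>

lemma turan_partition_of_extremal:
  assumes n: "card (pverts D) \<ge> 3" and "num_arcs D = (card (pverts D))\<^sup>2 div 4" "digon_verts = {}"
  shows "\<exists>V. turan_partition D 2 V"
proof -
  let ?n = "card (pverts D)" and ?s = "card sources" and ?t = "card sinks"
  have st: "?n = ?s + ?t" using card_verts assms(3) by simp
  have sub: "parcs D \<subseteq> sources \<times> sinks" using arcs_outside_digons assms(3) by simp
  have "num_arcs D \<le> ?s * ?t" using num_arcs_le assms(3) by simp
  have "?n\<^sup>2 < 4 * num_arcs D + 4" using assms(2) by simp
  then have "int (?n\<^sup>2) < int (4 * num_arcs D + 4)" by (simp only: of_nat_less_iff)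
  then have "(int ?s - int ?t)\<^sup>2 < 2\<^sup>2" using deficit_le assms(3) by simp
  then have "\<bar>int ?s - int ?t\<bar> < 2"
    by (intro power2_less_imp_less[where y = 2]) auto
  then have bal: "?s \<le> ?t + 1" "?t \<le> ?s + 1" by linarith+
  \<comment> \<open>The inequality 4st \<le> (s + t)^2 survives rounding down and yields st \<le>
    \<open>num_arcs D\<close>, so the inclusion \<open>sub\<close> is an equality by
    cardinality.\<close>
  have "4 * (?s * ?t) \<le> ?n\<^sup>2"
    unfolding st using zero_le_power2[of "int ?s - int ?t"]
    by (simp add: power2_eq_square algebra_simps flip: of_nat_mult of_nat_add)
  then have "?s * ?t \<le> num_arcs D" using assms(2) by simp
  then have arcs: "parcs D = sources \<times> sinks"
    using card_subset_eq[OF _ sub] card_mono[OF _ sub] finite_parts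
    unfolding num_arcs_def by (simp add: card_cartesian_product)
  have ne: "sources \<noteq> {}" "sinks \<noteq> {}" using bal n st by auto
  have dis: "sources \<inter> sinks = {}" by (auto simp: sources_def sinks_def)
  have un: "pverts D = sources \<union> sinks" using assms(3) by (auto simp: sources_def sinks_def)
  define V where "V = (\<lambda>i::nat. if i = 1 then sources else sinks)"
  have I: "{1..2::nat} = {1, 2}" by auto
  have "turan_partition D 2 V"
    unfolding turan_partition_def partition_on_def disjoint_def arcs_only_from_to_def I
    using ne dis un bal arcs by (auto simp: V_def inj_on_def)
  then show ?thesis by blast
qed

text \<open>Extremality forces a(2n - a - 4) \<le> 1, while this product is at least 2 in all cases
  but the two listed.\<close>

lemma extremal_digons:
  assumes n: "card (pverts D) \<ge> 3" and e: "num_arcs D = (card (pverts D))\<^sup>2 div 4"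
    and ne: "digon_verts \<noteq> {}"
  shows "card (pverts D) = 3 \<or> card (pverts D) = 4 \<and> card digon_verts = 4"
proof (rule ccontr)
  assume neg: "\<not> ?thesis"
  define n a where "n = int (card (pverts D))" and "a = int (card digon_verts)"
  \<comment> \<open>Squares are 0 or 1 modulo 4, so rounding costs at most 1. The crude bound 3
    would not exclude n = 4 with a = 1 or a = 3.\<close>
  have "(card (pverts D))\<^sup>2 mod 4 \<le> 1"
  proof (cases "even (card (pverts D))")
    case True
    then show ?thesis by (auto elim!: evenE simp: power2_eq_square)
  next
    case False
    then obtain m where "card (pverts D) = 2 * m + 1" by (rule oddE)
    then have "(card (pverts D))\<^sup>2 = 4 * (m * m + m) + 1"
      by (simp add: power2_eq_square algebra_simps)
    then show ?thesis by presburger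
  qed
  then have "(card (pverts D))\<^sup>2 \<le> 4 * num_arcs D + 1"
    unfolding e using div_mult_mod_eq[of "(card (pverts D))\<^sup>2" 4] by linarith
  then have "int ((card (pverts D))\<^sup>2) \<le> int (4 * num_arcs D + 1)" by (simp only: of_nat_le_iff)
  then have "n\<^sup>2 - 4 * int (num_arcs D) \<le> 1" by (simp add: n_def)
  then have le: "a * (2 * n - a - 4) \<le> 1"
    using deficit_le zero_le_power2[of "int (card sources) - int (card sinks)"]
    unfolding n_def a_def by linarith
  have a: "0 < a" "a \<le> n" "n \<ge> 3"
    using ne finite_parts card_verts n by (auto simp: a_def n_def card_gt_0_iff)
  \<comment> \<open>The product is 2n - 5 \<ge> 5 in the first case and 3, 4, 3 in the last. In the
    second, 2n - a - 4 \<ge> n - 4 \<ge> 1.\<close>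
  consider "n \<ge> 5" "a = 1" | "n \<ge> 5" "a \<ge> 2" | "n = 4" "a \<in> {1, 2, 3}"
    using a neg unfolding n_def a_def by force
  then show False
  proof cases
    case 2
    then have "2 * 1 \<le> a * (2 * n - a - 4)" using a by (intro mult_mono) auto
    then show False using le by simp
  qed (use le in auto)
qed

end

lemma P3_free_digraphI:
  assumes "pair_digraph D" "H_free (directed_path 3) D"
  shows "P3_free_digraph D"
  using assms(1)
proof (rule P3_free_digraph.intro)
  show "P3_free_digraph_axioms D"
    by unfold_locales (rule P3_free_iff[THEN iffD1, rule_format, OF assms])
qed

section \<open>Two-part Turan digraphs\<close>

text \<open>The general count \<open>turan_partition_arcs\<close> at k = 2, evaluated by the parity
  of n on any one member of the family.\<close>

lemma turan_arcs_2:
  assumes "n \<ge> 2"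
  shows "turan_arcs n 2 = n\<^sup>2 div 4"
proof -
  have "turan_arcs n 2 \<in> num_arcs ` turan_digraphs n 2"
    using turan_arcs_well_defined[of 2 n] assms by simp
  then obtain D where a: "turan_arcs n 2 = num_arcs D" and "D \<in> turan_digraphs n 2"
    by (rule imageE)
  then obtain V where D: "pair_digraph D" "turan_partition D 2 V" "card (pverts D) = n"
    unfolding turan_digraphs_def by blast
  have eq: "2 * turan_arcs n 2 + (2 * (n div 2)\<^sup>2 + (2 * (n div 2) + 1) * (n mod 2)) = n\<^sup>2"
    using turan_partition_arcs[OF D(1,2)] D(3) a by simp
  show ?thesis
  proof (cases "even n")
    case True
    then obtain m where "n = 2 * m" by (rule evenE)
    then show ?thesis using eq by (simp add: power2_eq_square)
  next
    case False
    then obtain m where m: "n = 2 * m + 1" by (rule oddE)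
    then have "n div 2 = m" "n mod 2 = 1" by simp_all
    then have "2 * turan_arcs n 2 + 2 * (m * m) + 2 * m + 1 = 4 * (m * m) + 4 * m + 1"
      using eq by (simp add: m power2_eq_square)
    moreover have "n\<^sup>2 = 4 * (m * m + m) + 1"
      unfolding m by (simp add: power2_eq_square algebra_simps)
    ultimately show ?thesis by simp
  qed
qed

text \<open>Every arc goes from \<open>V 1\<close> to \<open>V 2\<close>, so the head of an arc is
  never a tail.\<close>

lemma turan_digraphs_2_free: "turan_digraphs n 2 \<subseteq> free_digraphs n (directed_path 3)"
proof
  fix D assume "D \<in> turan_digraphs n 2"
  then obtain V where D: "pair_digraph D" "card (pverts D) = n" and V: "turan_partition D 2 V"
    by (auto simp: turan_digraphs_def)
  interpret pair_digraph D by fact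
  have I: "{1..2::nat} = {1, 2}" by auto
  have un: "pverts D = V 1 \<union> V 2"
    using V unfolding turan_partition_def partition_on_def I by simp
  have indep: "(u, v) \<notin> parcs D" if "u \<in> V i" "v \<in> V i" "i \<in> {1, 2}" for u v i
    using V that unfolding turan_partition_def I by blast
  have "arcs_only_from_to D (V 1) (V 2)"
    using V unfolding turan_partition_def I by simp
  then have no_rev: "(v, u) \<notin> parcs D" if "u \<in> V 1" "v \<in> V 2" for u v
    using that unfolding arcs_only_from_to_def by blast
  have arc: "u \<in> V 1" "v \<in> V 2" if "(u, v) \<in> parcs D" for u v
  proof -
    have "u \<in> V 1 \<union> V 2" "v \<in> V 1 \<union> V 2" using in_arcsD1 in_arcsD2 that un by blast+
    then show "u \<in> V 1" "v \<in> V 2"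
      using indep[of u 1 v] indep[of u 2 v] no_rev[of v u] that by blast+
  qed
  have "(v, w) \<notin> parcs D" if "(u, v) \<in> parcs D" for u v w
    using arc(2)[OF that] arc(2)[of v w] indep[of v 2 w] by blast
  then have "\<forall>u v w. (u, v) \<in> parcs D \<longrightarrow> (v, w) \<in> parcs D \<longrightarrow> u = w" by blast
  then have "H_free (directed_path 3) D" unfolding P3_free_iff[OF D(1)] .
  then show "D \<in> free_digraphs n (directed_path 3)" using D by (simp add: free_digraphs_def)
qed

section \<open>The exceptional digraphs on three and four vertices\<close>

lemma complete_graph_doubleton: "u \<noteq> v \<Longrightarrow> complete_graph {u, v} = ({u, v}, {{u, v}})"
  unfolding complete_graph_def by (intro arg_cong[where f = "Pair {u, v}"] equalityI subsetI) blast+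

lemma complete_graph_singleton: "complete_graph {u} = ({u}, {})"
  by (simp add: complete_graph_def)

lemma complete_graph_empty: "complete_graph {} = ({}, {})"
  by (simp add: complete_graph_def)

lemma bidirect_Gamma_3:
  "bidirect (Gamma_graph 3 2) = \<lparr>pverts = {0, 1, 2}, parcs = {(0, 1), (1, 0)}\<rparr>"
proof -
  have "{complete_graph {c * 2..<c * 2 + 2} |c. c < (3::nat) div 2} = {complete_graph {0, 1}}"
    by (auto simp: atLeastLessThan_upt upt_rec)
  \<comment> \<open>The remainder block is a single vertex and adds no edge.\<close>
  moreover have "{3 div 2 * 2..<3::nat} = {2}" by auto
  ultimately show ?thesis
    by (auto simp: Gamma_graph_def graph_Union_def bidirect_def complete_graph_doubleton
        complete_graph_singleton doubleton_eq_iff)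
qed

lemma bidirect_Gamma_4:
  "bidirect (Gamma_graph 4 2) =
    \<lparr>pverts = {0, 1, 2, 3}, parcs = {(0, 1), (1, 0), (2, 3), (3, 2)}\<rparr>"
proof -
  have "{complete_graph {c * 2..<c * 2 + 2} |c. c < (4::nat) div 2} =
      (\<lambda>c. complete_graph {c * 2..<c * 2 + 2}) ` {c. c < 4 div 2}"
    by (rule setcompr_eq_image)
  also have "{c. c < (4::nat) div 2} = {0, 1}" by auto
  also have "(\<lambda>c. complete_graph {c * 2..<c * 2 + 2}) ` {0, 1} =
      {complete_graph {0, 1}, complete_graph {2, 3::nat}}"
    by (simp add: atLeastLessThan_upt upt_rec)
  \<comment> \<open>Here the remainder block is empty, hence \<open>complete_graph_empty\<close>;
    \<open>doubleton_eq_iff\<close> turns each edge into its two orientations.\<close>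
  finally show ?thesis
    by (auto simp: Gamma_graph_def graph_Union_def bidirect_def complete_graph_doubleton
        complete_graph_empty doubleton_eq_iff)
qed

lemma bidirect_Gamma_extremal:
  assumes "n = 3 \<or> n = 4"
  shows "bidirect (Gamma_graph n 2) \<in> free_digraphs n (directed_path 3)"
    and "num_arcs (bidirect (Gamma_graph n 2)) = n\<^sup>2 div 4"
proof -
  let ?G = "bidirect (Gamma_graph n 2)"
  have G: "pair_digraph ?G"
    using assms by unfold_locales (auto simp: bidirect_Gamma_3 bidirect_Gamma_4)
  have "H_free (directed_path 3) ?G"
    unfolding P3_free_iff[OF G] using assms by (auto simp: bidirect_Gamma_3 bidirect_Gamma_4)
  then show "?G \<in> free_digraphs n (directed_path 3)"
    using G assms by (auto simp: free_digraphs_def bidirect_Gamma_3 bidirect_Gamma_4)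
  show "num_arcs ?G = n\<^sup>2 div 4"
    using assms by (auto simp: num_arcs_def bidirect_Gamma_3 bidirect_Gamma_4)
qed

text \<open>In both orders left by \<open>extremal_digons\<close> the arc set is known explicitly,
  so numbering the vertices digon by digon gives the isomorphism.\<close>

lemma (in P3_free_digraph) extremal_digons_iso:
  assumes "card (pverts D) = n" "n \<ge> 3" "num_arcs D = n\<^sup>2 div 4" "digon_verts \<noteq> {}"
  shows "n = 3 \<or> n = 4" and "digraph_iso (with_proj D) (with_proj (bidirect (Gamma_graph n 2)))"
proof -
  have cases: "n = 3 \<or> n = 4 \<and> card digon_verts = 4" using extremal_digons assms by simp
  then show "n = 3 \<or> n = 4" by blast
  show "digraph_iso (with_proj D) (with_proj (bidirect (Gamma_graph n 2)))"
  proof (cases "n = 3")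
    case True
    obtain u v w where D: "pverts D = {u, v, w}" "distinct [u, v, w]"
      "parcs D = {(u, v), (v, u)}"
      by (rule digon_order_3) (use True assms in auto)
    show ?thesis
      unfolding \<open>n = 3\<close> bidirect_Gamma_3
      by (rule digraph_iso_with_projI[where f = "\<lambda>x. if x = u then 0 else if x = v then 1 else 2"])
        (use D pair_wf_digraph_axioms in auto)
  next
    case False
    then have "n = 4" "card digon_verts = 4" using cases by auto
    obtain u v w x where D: "pverts D = {u, v, w, x}" "distinct [u, v, w, x]"
      "parcs D = {(u, v), (v, u), (w, x), (x, w)}"
      by (rule digons_order_4) (use \<open>n = 4\<close> \<open>card digon_verts = 4\<close> assms in auto)
    define f where "f = (\<lambda>y. if y = u then 0 else if y = v then 1 else if y = w then 2 else 3 :: nat)"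
    have f: "f u = 0" "f v = 1" "f w = 2" "f x = 3" using D(2) by (auto simp: f_def)
    show ?thesis
      unfolding \<open>n = 4\<close> bidirect_Gamma_4
      by (rule digraph_iso_with_projI[where f = f, OF pair_wf_digraph_axioms])
        (simp_all add: D f inj_on_def)
  qed
qed

section \<open>The extremal number and the extremal families\<close>

theorem theorem1p5:
  fixes n :: nat
  assumes "n \<ge> 3"
  shows "ex_num n (directed_path 3) = turan_arcs n 2 \<and>
         int (turan_arcs n 2) = \<lfloor>(real n)\<^sup>2 / 4\<rfloor> \<and>
         (n \<ge> 5 \<longrightarrow> EX_fam n (directed_path 3) \<doteq> turan_digraphs n 2) \<and>
         (n = 3 \<or> n = 4 \<longrightarrow>
            EX_fam n (directed_path 3) \<doteq> turan_digraphs n 2 \<union> {bidirect (Gamma_graph n 2)})"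
proof -
  let ?P = "directed_path 3"
  have arcs: "turan_arcs n 2 = n\<^sup>2 div 4" using turan_arcs_2 assms by simp
  \<comment> \<open>Equality with a singleton also records that the family is nonempty, which
    provides the maximiser for \<open>ex\<close>.\<close>
  have img: "num_arcs ` turan_digraphs n 2 = {n\<^sup>2 div 4}"
    using turan_arcs_well_defined[of 2 n] arcs assms by simp
  have le: "num_arcs D \<le> n\<^sup>2 div 4" if D: "D \<in> free_digraphs n ?P" for D
  proof -
    interpret P3_free_digraph D using D by (auto simp: free_digraphs_def intro: P3_free_digraphI)
    show ?thesis using num_arcs_le_Mantel D assms by (simp add: free_digraphs_def)
  qed
  have ex: "ex_num n ?P = n\<^sup>2 div 4"
    unfolding ex_num_def
  proof (rule Max_eqI)
    show "finite (num_arcs ` free_digraphs n ?P)"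
      by (rule finite_subset[of _ "{..n\<^sup>2 div 4}"]) (use le in auto)
    show "n\<^sup>2 div 4 \<in> num_arcs ` free_digraphs n ?P"
      using img turan_digraphs_2_free[of n] by blast
  qed (use le in auto)
  have fl: "int (turan_arcs n 2) = \<lfloor>(real n)\<^sup>2 / 4\<rfloor>"
    unfolding arcs using floor_divide_of_nat_eq[of "n\<^sup>2" 4, where ?'a = real] by simp
  have turan_EX: "turan_digraphs n 2 \<subseteq> EX_fam n ?P"
    using turan_digraphs_2_free img by (auto simp: EX_fam_def ex)
  \<comment> \<open>The dichotomy is whether \<open>D\<close> has a digon; the second alternative
    can occur only for n = 3 and n = 4.\<close>
  have EX_cases: "D \<in> turan_digraphs n 2 \<or>
      (n = 3 \<or> n = 4) \<and> digraph_iso (with_proj D) (with_proj (bidirect (Gamma_graph n 2)))"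
    if "D \<in> EX_fam n ?P" for D
  proof -
    have D: "pair_digraph D" "card (pverts D) = n" "H_free ?P D" "num_arcs D = n\<^sup>2 div 4"
      using that by (auto simp: EX_fam_def free_digraphs_def ex)
    interpret P3_free_digraph D using D by (auto intro: P3_free_digraphI)
    show ?thesis
    proof (cases "digon_verts = {}")
      case True
      then show ?thesis using turan_partition_of_extremal D assms by (simp add: turan_digraphs_def)
    next
      case False
      then show ?thesis using extremal_digons_iso D assms by blast
    qed
  qed
  \<comment> \<open>In comparing families up to isomorphism, a digraph lying in both serves as its
    own partner.\<close>
  have refl: "digraph_iso (with_proj D) (with_proj D)" if "pair_wf_digraph D"
    for D :: "nat pair_pre_digraph"
    using that by (intro digraph_iso_with_projI[where f = id]) (auto simp: map_prod.id)
  have turan_refl: "digraph_iso (with_proj D) (with_proj D)" if "D \<in> turan_digraphs n 2" for D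
    using that by (intro refl) (auto simp: turan_digraphs_def pair_digraph_def pair_fin_digraph_def)
  have large: "EX_fam n ?P \<doteq> turan_digraphs n 2" if "n \<ge> 5"
    unfolding same_up_to_iso_def using EX_cases turan_EX turan_refl that by fastforce
  have small: "EX_fam n ?P \<doteq> turan_digraphs n 2 \<union> {bidirect (Gamma_graph n 2)}"
    if "n = 3 \<or> n = 4"
  proof -
    have "bidirect (Gamma_graph n 2) \<in> EX_fam n ?P"
      using bidirect_Gamma_extremal[OF that] by (simp add: EX_fam_def ex)
    moreover have "pair_wf_digraph (bidirect (Gamma_graph n 2))"
      using bidirect_Gamma_extremal(1)[OF that]
      by (auto simp: free_digraphs_def pair_digraph_def pair_fin_digraph_def)
    ultimately show ?thesis
      unfolding same_up_to_iso_def using EX_cases turan_EX turan_refl refl by blast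
  qed
  have "ex_num n ?P = turan_arcs n 2" using arcs ex by simp
  then show ?thesis using fl large small by blast
qed

end
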